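(* Let $F$ be a field of characteristic zero, $G$ a finite group, and $A$ a $G$-graded $F$-algebra. Then the multiplier algebra $\mathcal{M}(A)$ of $A$ is $G$-graded as follows: $$\mathcal{M}(A)=\bigoplus_{g\in G}\mathcal{M}(A)^g,$$ where, for each $g\in G$, $$\mathcal{M}(A)^g=\{(R,L)\in\mathcal{M}(A)\mid R(A^h)\subseteq A^{hg}\ \text{and}\ L(A^h)\subseteq A^{gh}\ \text{for all } h\in G\}.$$
   Context: Algebras are associative over $F$, not necessarily unital. A $G$-grading on an algebra $A$ is a vector space decomposition $A=\bigoplus_{g\in G}A^g$ with $A^gA^h\subseteq A^{gh}$. Let $\mathrm{End}_F(A)$ be the algebra of linear endomorphisms of $A$ under composition and $\mathrm{End}_F(A)^{\mathrm{op}}$ its opposite. A pair $(R,L)\in \mathrm{End}_F(A)^{\mathrm{op}}\times\mathrm{End}_F(A)$ is a multiplier of $A$ if $R(ab)=aR(b)$, $L(ab)=L(a)b$, and $R(a)b=aL(b)$ for all $a,b\in A$. The set $\mathcal{M}(A)$ of all multipliers is a unital algebra with component-wise operations, so $(R_1,L_1)(R_2,L_2)=(R_2R_1,L_1L_2)$, with unit $(\mathrm{id}_A,\mathrm{id}_A)$. *)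

theory Defs
  imports Complex_Main "HOL-Algebra.Group" "HOL-Library.Function_Algebras" "HOL-Library.Product_Plus"
begin

text \<open>
  Associative, not necessarily unital algebras, carried by a subspace \<open>C\<close> of a vector space.
  The carrier is needed because the multipliers form only part of the type of pairs of functions;
  a full type is the case \<open>C = UNIV\<close>.
\<close>

locale algebra_on = vector_space scale
  for scale :: "'f::field \<Rightarrow> 'v::ab_group_add \<Rightarrow> 'v" +
  fixes mul :: "'v \<Rightarrow> 'v \<Rightarrow> 'v"
    and C :: "'v set"
  assumes subspace_carrier: "subspace C"
    and mul_closed: "\<lbrakk>x \<in> C; y \<in> C\<rbrakk> \<Longrightarrow> mul x y \<in> C"
    and mul_assoc: "\<lbrakk>x \<in> C; y \<in> C; z \<in> C\<rbrakk> \<Longrightarrow> mul (mul x y) z = mul x (mul y z)"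
    and mul_add_left: "\<lbrakk>x \<in> C; y \<in> C; z \<in> C\<rbrakk> \<Longrightarrow> mul (x + y) z = mul x z + mul y z"
    and mul_add_right: "\<lbrakk>x \<in> C; y \<in> C; z \<in> C\<rbrakk> \<Longrightarrow> mul x (y + z) = mul x y + mul x z"
    and mul_scale_left: "\<lbrakk>x \<in> C; y \<in> C\<rbrakk> \<Longrightarrow> mul (scale c x) y = scale c (mul x y)"
    and mul_scale_right: "\<lbrakk>x \<in> C; y \<in> C\<rbrakk> \<Longrightarrow> mul x (scale c y) = scale c (mul x y)"

text \<open>
  The direct sum is expressed by unique finitely supported families of homogeneous components.
  Families are set to zero outside \<open>carrier G\<close> so that uniqueness is not spoiled by junk values.
\<close>

locale graded_algebra_on = algebra_on scale mul C + group G
  for scale :: "'f::field \<Rightarrow> 'v::ab_group_add \<Rightarrow> 'v"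
    and mul :: "'v \<Rightarrow> 'v \<Rightarrow> 'v"
    and C :: "'v set"
    and G :: "('g, 'm) monoid_scheme" (structure) +
  fixes comp :: "'g \<Rightarrow> 'v set"
  assumes comp_subspace: "g \<in> carrier G \<Longrightarrow> subspace (comp g)"
    and comp_subset: "g \<in> carrier G \<Longrightarrow> comp g \<subseteq> C"
    and direct_sum: "x \<in> C \<Longrightarrow>
      \<exists>!f. (\<forall>g\<in>carrier G. f g \<in> comp g) \<and> (\<forall>g. g \<notin> carrier G \<longrightarrow> f g = 0) \<and>
           finite {g. f g \<noteq> 0} \<and> x = (\<Sum>g | f g \<noteq> 0. f g)"
    and comp_mul: "\<lbrakk>g \<in> carrier G; h \<in> carrier G; x \<in> comp g; y \<in> comp h\<rbrakk>
      \<Longrightarrow> mul x y \<in> comp (g \<otimes> h)"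

definition multipliers ::
  "('f::field \<Rightarrow> 'a::ring \<Rightarrow> 'a) \<Rightarrow> (('a \<Rightarrow> 'a) \<times> ('a \<Rightarrow> 'a)) set" where
  "multipliers scale =
    {(R, L). Vector_Spaces.linear scale scale R \<and> Vector_Spaces.linear scale scale L \<and>
       (\<forall>a b. R (a * b) = a * R b) \<and>
       (\<forall>a b. L (a * b) = L a * b) \<and>
       (\<forall>a b. R a * b = a * L b)}"

text \<open>
  Addition of pairs of functions is the pointwise one of the imported class instances.
  The product composes the first components in opposite order; it is unrelated to the
  pointwise product of functions that is also imported.
\<close>

definition multiplier_scale ::
  "('f \<Rightarrow> 'a \<Rightarrow> 'a) \<Rightarrow> 'f \<Rightarrow> ('a \<Rightarrow> 'a) \<times> ('a \<Rightarrow> 'a) \<Rightarrow> ('a \<Rightarrow> 'a) \<times> ('a \<Rightarrow> 'a)" where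
  "multiplier_scale scale c = (\<lambda>(R, L). (\<lambda>a. scale c (R a), \<lambda>a. scale c (L a)))"

definition multiplier_mul ::
  "('a \<Rightarrow> 'a) \<times> ('a \<Rightarrow> 'a) \<Rightarrow> ('a \<Rightarrow> 'a) \<times> ('a \<Rightarrow> 'a) \<Rightarrow> ('a \<Rightarrow> 'a) \<times> ('a \<Rightarrow> 'a)" where
  "multiplier_mul = (\<lambda>(R\<^sub>1, L\<^sub>1) (R\<^sub>2, L\<^sub>2). (R\<^sub>2 \<circ> R\<^sub>1, L\<^sub>1 \<circ> L\<^sub>2))"

definition multiplier_comp ::
  "('f::field \<Rightarrow> 'a::ring \<Rightarrow> 'a) \<Rightarrow> ('g, 'm) monoid_scheme \<Rightarrow> ('g \<Rightarrow> 'a set) \<Rightarrow>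
   'g \<Rightarrow> (('a \<Rightarrow> 'a) \<times> ('a \<Rightarrow> 'a)) set" where
  "multiplier_comp scale G A g =
    {(R, L). (R, L) \<in> multipliers scale \<and>
       (\<forall>h\<in>carrier G. R ` A h \<subseteq> A (h \<otimes>\<^bsub>G\<^esub> g) \<and> L ` A h \<subseteq> A (g \<otimes>\<^bsub>G\<^esub> h))}"

end

theory Submission
  imports Defs
begin

text \<open>
  Since the group is finite, every linear endomorphism \<open>T\<close> of \<open>A\<close> is a finite matrix of blocks
  \<open>A\<^sup>h \<rightarrow> A\<^sup>k\<close>. Call the blocks lying on the graph of a map \<open>\<sigma>\<close> on \<open>G\<close>, that is those with
  \<open>k = \<sigma> h\<close>, the part of \<open>T\<close> along \<open>\<sigma>\<close>; it is the sum over \<open>h\<close> of \<open>p\<^bsub>\<sigma> h\<^esub> \<circ> T \<circ> p\<^sub>h\<close>, where \<open>p\<^sub>h\<close> is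
  the projection to \<open>A\<^sup>h\<close>. The graphs of the right translations by the elements of \<open>G\<close>
  partition \<open>G \<times> G\<close>, and so do those of the left translations. Hence \<open>T\<close> is the sum of its
  parts along all right translations, and these parts are the only summands of these shapes
  (\<open>sum_part_along\<close>, \<open>part_along_unique\<close>); likewise on the left.

  Consequently the component of degree \<open>g\<close> of a multiplier \<open>(R, L)\<close> can only be the pair
  \<open>(R\<^sub>g, L\<^sub>g)\<close>, with \<open>R\<^sub>g\<close> the part of \<open>R\<close> along \<open>h \<mapsto> h g\<close> and \<open>L\<^sub>g\<close> the part of \<open>L\<close> along
  \<open>h \<mapsto> g h\<close>. The point is that this pair is again a multiplier (\<open>multiplier_part_in_comp\<close>).
  By bilinearity the three identities need only be checked on homogeneous \<open>a \<in> A\<^sup>s\<close> and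
  \<open>b \<in> A\<^sup>h\<close>, where each arises from an identity for \<open>(R, L)\<close> by taking one homogeneous
  component, because multiplication by a homogeneous element shifts components. For example,
  the component of degree \<open>s g h\<close> of \<open>R a * b = a * L b\<close> reads \<open>R\<^sub>g a * b = a * L\<^sub>g b\<close>.
\<close>

section \<open>Homogeneous components\<close>

locale finite_graded_ring = graded_algebra_on scale "(*)" UNIV G A
  for scale :: "'f::field \<Rightarrow> 'a::ring \<Rightarrow> 'a"
    and G :: "('g, 'm) monoid_scheme" (structure)
    and A :: "'g \<Rightarrow> 'a set" +
  assumes finite_carrier: "finite (carrier G)"
begin

text \<open>
  The predicate is the one in the direct sum axiom, whose unique witness is the whole family of
  components of \<open>x\<close>.
\<close>

definition hom_part :: "'g \<Rightarrow> 'a \<Rightarrow> 'a" where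
  "hom_part g x = (THE f. (\<forall>g\<in>carrier G. f g \<in> A g) \<and> (\<forall>g. g \<notin> carrier G \<longrightarrow> f g = 0) \<and>
     finite {g. f g \<noteq> 0} \<and> x = (\<Sum>g | f g \<noteq> 0. f g)) g"

lemma sum_support_eq_sum_carrier:
  fixes f :: "'g \<Rightarrow> 'b::comm_monoid_add"
  assumes "\<forall>g. g \<notin> carrier G \<longrightarrow> f g = 0"
  shows "(\<Sum>g | f g \<noteq> 0. f g) = (\<Sum>g\<in>carrier G. f g)"
  using assms by (intro sum.mono_neutral_left) (auto simp: finite_carrier)

lemma finite_support:
  fixes f :: "'g \<Rightarrow> 'b::zero"
  assumes "\<forall>g. g \<notin> carrier G \<longrightarrow> f g = 0"
  shows "finite {g. f g \<noteq> 0}"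
  using assms by (intro finite_subset[OF _ finite_carrier]) auto

lemma hom_part_in [simp]: "g \<in> carrier G \<Longrightarrow> hom_part g x \<in> A g"
  and sum_hom_part: "(\<Sum>g\<in>carrier G. hom_part g x) = x"
proof -
  let ?P = "\<lambda>f. (\<forall>g\<in>carrier G. f g \<in> A g) \<and> (\<forall>g. g \<notin> carrier G \<longrightarrow> f g = 0) \<and>
     finite {g. f g \<noteq> 0} \<and> x = (\<Sum>g | f g \<noteq> 0. f g)"
  have "?P (\<lambda>g. hom_part g x)"
    unfolding hom_part_def using theI'[OF direct_sum[of x]] by simp
  then show "g \<in> carrier G \<Longrightarrow> hom_part g x \<in> A g"
    and "(\<Sum>g\<in>carrier G. hom_part g x) = x"
    using sum_support_eq_sum_carrier[of "\<lambda>g. hom_part g x"] by auto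
qed

lemma hom_part_unique:
  assumes f: "\<And>g. g \<in> carrier G \<Longrightarrow> f g \<in> A g"
    and x: "(\<Sum>g\<in>carrier G. f g) = x"
    and g: "g \<in> carrier G"
  shows "hom_part g x = f g"
proof -
  let ?P = "\<lambda>f. (\<forall>g\<in>carrier G. f g \<in> A g) \<and> (\<forall>g. g \<notin> carrier G \<longrightarrow> f g = 0) \<and>
     finite {g. f g \<noteq> 0} \<and> x = (\<Sum>g | f g \<noteq> 0. f g)"
  let ?f = "\<lambda>g. if g \<in> carrier G then f g else 0"
  have z: "\<forall>g. g \<notin> carrier G \<longrightarrow> ?f g = 0" by simp
  have "?P ?f"
    unfolding sum_support_eq_sum_carrier[OF z] using finite_support[OF z] f x by simp
  from the1_equality[of ?P, OF direct_sum[OF UNIV_I] this]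
  have "hom_part g x = ?f g"
    unfolding hom_part_def by (rule fun_cong)
  with g show ?thesis by simp
qed

lemma hom_part_add: "g \<in> carrier G \<Longrightarrow> hom_part g (x + y) = hom_part g x + hom_part g y"
  by (rule hom_part_unique) (auto simp: sum.distrib sum_hom_part intro: subspace_add comp_subspace)

lemma hom_part_scale: "g \<in> carrier G \<Longrightarrow> hom_part g (scale c x) = scale c (hom_part g x)"
  by (rule hom_part_unique)
    (auto simp: scale_sum_right[symmetric] sum_hom_part intro: subspace_scale comp_subspace)

lemma hom_part_sum:
  assumes "g \<in> carrier G"
  shows "hom_part g (\<Sum>i\<in>I. f i) = (\<Sum>i\<in>I. hom_part g (f i))"
  using hom_part_add[OF assms, of 0 0]
  by (induction I rule: infinite_finite_induct) (simp_all add: hom_part_add assms)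

lemma hom_part_homogeneous:
  assumes "h \<in> carrier G" "x \<in> A h" "g \<in> carrier G"
  shows "hom_part g x = (if g = h then x else 0)"
  by (rule hom_part_unique)
    (use assms in \<open>auto simp: finite_carrier intro: subspace_0 comp_subspace\<close>)

text \<open>
  Multiplying all components of \<open>x\<close> on the left by \<open>a\<close> gives homogeneous elements with sum \<open>a * x\<close>,
  whose degrees are distinct because left translation by \<open>s\<close> is injective. So these elements are
  the components of \<open>a * x\<close>.
\<close>

lemma hom_part_mult_left:
  assumes s: "s \<in> carrier G" and a: "a \<in> A s" and k: "k \<in> carrier G"
  shows "hom_part (s \<otimes> k) (a * x) = a * hom_part k x"
proof -
  let ?f = "\<lambda>m. a * hom_part (inv s \<otimes> m) x"
  have in_comp: "?f m \<in> A m" if "m \<in> carrier G" for m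
    using comp_mul[of s "inv s \<otimes> m" a "hom_part (inv s \<otimes> m) x"] s a that
    by (simp add: m_assoc[symmetric])
  have "(\<Sum>m\<in>carrier G. ?f m) = (\<Sum>k\<in>carrier G. a * hom_part k x)"
    by (rule sum.reindex_bij_witness[of _ "\<lambda>k. s \<otimes> k" "\<lambda>m. inv s \<otimes> m"])
      (use s in \<open>simp_all add: m_assoc[symmetric]\<close>)
  then have "(\<Sum>m\<in>carrier G. ?f m) = a * x"
    by (simp add: sum_distrib_left[symmetric] sum_hom_part)
  from hom_part_unique[of ?f, OF in_comp this, of "s \<otimes> k"] show ?thesis
    using s k by (simp add: m_assoc[symmetric])
qed

lemma hom_part_mult_right:
  assumes s: "s \<in> carrier G" and b: "b \<in> A s" and k: "k \<in> carrier G"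
  shows "hom_part (k \<otimes> s) (x * b) = hom_part k x * b"
proof -
  let ?f = "\<lambda>m. hom_part (m \<otimes> inv s) x * b"
  have in_comp: "?f m \<in> A m" if "m \<in> carrier G" for m
    using comp_mul[of "m \<otimes> inv s" s "hom_part (m \<otimes> inv s) x" b] s b that
    by (simp add: m_assoc)
  have "(\<Sum>m\<in>carrier G. ?f m) = (\<Sum>k\<in>carrier G. hom_part k x * b)"
    by (rule sum.reindex_bij_witness[of _ "\<lambda>k. k \<otimes> s" "\<lambda>m. m \<otimes> inv s"])
      (use s in \<open>simp_all add: m_assoc\<close>)
  then have "(\<Sum>m\<in>carrier G. ?f m) = x * b"
    by (simp add: sum_distrib_right[symmetric] sum_hom_part)
  from hom_part_unique[of ?f, OF in_comp this, of "k \<otimes> s"] show ?thesis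
    using s k by (simp add: m_assoc)
qed

lemma additive_eq_if_eq_on_homogeneous:
  fixes S T :: "'a \<Rightarrow> 'b::ab_group_add"
  assumes S: "\<And>x y. S (x + y) = S x + S y" and T: "\<And>x y. T (x + y) = T x + T y"
    and eq: "\<And>h x. h \<in> carrier G \<Longrightarrow> x \<in> A h \<Longrightarrow> S x = T x"
  shows "S x = T x"
proof -
  have zero: "S 0 = 0" "T 0 = 0"
    using S[of 0 0] T[of 0 0] by simp_all
  have "S (\<Sum>h\<in>I. hom_part h x) = T (\<Sum>h\<in>I. hom_part h x)"
    if "I \<subseteq> carrier G" for I
    using finite_subset[OF that finite_carrier] that
    by (induction I rule: finite_induct) (simp_all add: zero S T eq[OF _ hom_part_in])
  from this[OF subset_refl] show ?thesis
    by (simp add: sum_hom_part)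
qed

lemma biadditive_eq_if_eq_on_homogeneous:
  fixes S T :: "'a \<Rightarrow> 'a \<Rightarrow> 'b::ab_group_add"
  assumes "\<And>x y z. S (x + y) z = S x z + S y z" "\<And>x y z. S x (y + z) = S x y + S x z"
    and "\<And>x y z. T (x + y) z = T x z + T y z" "\<And>x y z. T x (y + z) = T x y + T x z"
    and eq: "\<And>s h a b. s \<in> carrier G \<Longrightarrow> h \<in> carrier G \<Longrightarrow> a \<in> A s \<Longrightarrow> b \<in> A h \<Longrightarrow> S a b = T a b"
  shows "S a b = T a b"
proof (rule additive_eq_if_eq_on_homogeneous[of "\<lambda>a. S a b" "\<lambda>a. T a b"])
  fix s a assume "s \<in> carrier G" "a \<in> A s"
  with eq show "S a b = T a b"
    using additive_eq_if_eq_on_homogeneous[of "S a" "T a" b] assms(2,4) by blast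
qed (simp_all add: assms(1-4))

section \<open>The part of an endomorphism along a map of degrees\<close>

definition part_along :: "('g \<Rightarrow> 'g) \<Rightarrow> ('a \<Rightarrow> 'a) \<Rightarrow> 'a \<Rightarrow> 'a" where
  "part_along \<sigma> T x = (\<Sum>h\<in>carrier G. hom_part (\<sigma> h) (T (hom_part h x)))"

lemma linear_on_carrier_iff:
  "Vector_Spaces.linear scale scale T \<longleftrightarrow>
     (\<forall>x y. T (x + y) = T x + T y) \<and> (\<forall>c x. T (scale c x) = scale c (T x))"
  by (simp add: Vector_Spaces.linear_iff vector_space_axioms)

lemma linear_part_along:
  assumes "Vector_Spaces.linear scale scale T" "\<And>h. h \<in> carrier G \<Longrightarrow> \<sigma> h \<in> carrier G"
  shows "Vector_Spaces.linear scale scale (part_along \<sigma> T)"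
  using assms unfolding linear_on_carrier_iff part_along_def
  by (simp add: hom_part_add hom_part_scale sum.distrib scale_sum_right)

lemma part_along_homogeneous:
  assumes T: "Vector_Spaces.linear scale scale T"
    and \<sigma>: "\<And>h. h \<in> carrier G \<Longrightarrow> \<sigma> h \<in> carrier G"
    and h: "h \<in> carrier G" "x \<in> A h"
  shows "part_along \<sigma> T x = hom_part (\<sigma> h) (T x)"
proof -
  have T0: "T 0 = 0"
    using T unfolding linear_on_carrier_iff by (metis add_cancel_right_right)
  have z: "hom_part g 0 = 0" if "g \<in> carrier G" for g
    using hom_part_add[OF that, of 0 0] by simp
  have "part_along \<sigma> T x = (\<Sum>k\<in>carrier G. if k = h then hom_part (\<sigma> h) (T x) else 0)"
    unfolding part_along_def
    by (rule sum.cong) (auto simp: hom_part_homogeneous[OF h] T0 z \<sigma>)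
  then show ?thesis
    using h finite_carrier by simp
qed

text \<open>
  Bijectivity in \<open>g\<close> says that the graphs of the maps \<open>\<sigma> g\<close> partition the set of pairs of degrees,
  so every block of \<open>T\<close> is counted exactly once.
\<close>

lemma sum_part_along:
  assumes T: "Vector_Spaces.linear scale scale T"
    and \<sigma>: "\<And>h. h \<in> carrier G \<Longrightarrow> bij_betw (\<lambda>g. \<sigma> g h) (carrier G) (carrier G)"
  shows "(\<Sum>g\<in>carrier G. part_along (\<sigma> g) T x) = T x"
proof (rule additive_eq_if_eq_on_homogeneous[of "\<lambda>x. \<Sum>g\<in>carrier G. part_along (\<sigma> g) T x" T])
  have \<sigma>_in: "\<sigma> g h \<in> carrier G" if "g \<in> carrier G" "h \<in> carrier G" for g h
    using bij_betw_apply[OF \<sigma>] that by blast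
  show T_add: "T (x + y) = T x + T y" for x y
    using T by (simp add: linear_on_carrier_iff)
  show "(\<Sum>g\<in>carrier G. part_along (\<sigma> g) T (x + y)) =
      (\<Sum>g\<in>carrier G. part_along (\<sigma> g) T x) + (\<Sum>g\<in>carrier G. part_along (\<sigma> g) T y)" for x y
    unfolding part_along_def by (simp add: hom_part_add T_add \<sigma>_in sum.distrib)
  fix h x assume h: "h \<in> carrier G" "x \<in> A h"
  have "(\<Sum>g\<in>carrier G. part_along (\<sigma> g) T x) = (\<Sum>g\<in>carrier G. hom_part (\<sigma> g h) (T x))"
    by (intro sum.cong refl part_along_homogeneous[OF T _ h] \<sigma>_in)
  also have "\<dots> = (\<Sum>k\<in>carrier G. hom_part k (T x))"
    by (rule sum.reindex_bij_betw[OF \<sigma>[OF h(1)]])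
  finally show "(\<Sum>g\<in>carrier G. part_along (\<sigma> g) T x) = T x"
    by (simp add: sum_hom_part)
qed

text \<open>
  On \<open>A h\<close> the summands \<open>S k\<close> take values in the distinct degrees \<open>\<sigma> k h\<close>, so projecting
  the sum \<open>T x\<close> to degree \<open>\<sigma> g h\<close> isolates \<open>S g x\<close>.
\<close>

lemma part_along_unique:
  assumes T: "Vector_Spaces.linear scale scale T"
    and \<sigma>: "\<And>g h. g \<in> carrier G \<Longrightarrow> h \<in> carrier G \<Longrightarrow> \<sigma> g h \<in> carrier G"
    and inj: "\<And>h. h \<in> carrier G \<Longrightarrow> inj_on (\<lambda>g. \<sigma> g h) (carrier G)"
    and S: "\<And>g. g \<in> carrier G \<Longrightarrow> Vector_Spaces.linear scale scale (S g)"
    and S_in: "\<And>g h x. g \<in> carrier G \<Longrightarrow> h \<in> carrier G \<Longrightarrow> x \<in> A h \<Longrightarrow> S g x \<in> A (\<sigma> g h)"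
    and sum: "\<And>x. (\<Sum>g\<in>carrier G. S g x) = T x"
    and g: "g \<in> carrier G"
  shows "S g = part_along (\<sigma> g) T"
proof
  fix x show "S g x = part_along (\<sigma> g) T x"
  proof (rule additive_eq_if_eq_on_homogeneous[of "S g" "part_along (\<sigma> g) T"])
    show "S g (x + y) = S g x + S g y" for x y
      using S[OF g] by (simp add: linear_on_carrier_iff)
    show "part_along (\<sigma> g) T (x + y) = part_along (\<sigma> g) T x + part_along (\<sigma> g) T y" for x y
      using linear_part_along[OF T \<sigma>[OF g]] by (simp add: linear_on_carrier_iff)
    fix h x assume h: "h \<in> carrier G" "x \<in> A h"
    have "part_along (\<sigma> g) T x = hom_part (\<sigma> g h) (\<Sum>k\<in>carrier G. S k x)"
      by (simp add: part_along_homogeneous[OF T \<sigma>[OF g] h] sum)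
    also have "\<dots> = (\<Sum>k\<in>carrier G. hom_part (\<sigma> g h) (S k x))"
      by (rule hom_part_sum[OF \<sigma>[OF g h(1)]])
    also have "\<dots> = (\<Sum>k\<in>carrier G. if k = g then S g x else 0)"
    proof (rule sum.cong)
      fix k assume k: "k \<in> carrier G"
      have "\<sigma> g h = \<sigma> k h \<longleftrightarrow> k = g"
        using inj_on_eq_iff[OF inj[OF h(1)] g k] by auto
      then show "hom_part (\<sigma> g h) (S k x) = (if k = g then S g x else 0)"
        using hom_part_homogeneous[OF \<sigma>[OF k h(1)] S_in[OF k h] \<sigma>[OF g h(1)]] by simp
    qed simp
    finally show "S g x = part_along (\<sigma> g) T x"
      using g finite_carrier by simp
  qed
qed

section \<open>The multiplier algebra\<close>

lemma algebra_on_multipliers: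
  "algebra_on (multiplier_scale scale) multiplier_mul (multipliers scale)"
proof -
  interpret M: vector_space "multiplier_scale scale"
    by unfold_locales
      (auto simp: multiplier_scale_def fun_eq_iff algebra_simps scale_left_distrib
        scale_right_distrib)
  have mult_scale: "scale c x * y = scale c (x * y)" "x * scale c y = scale c (x * y)" for c x y
    using mul_scale_left[of x y c] mul_scale_right[of x y c] by simp_all
  show ?thesis
  proof
    show "M.subspace (multipliers scale)"
      unfolding M.subspace_def multipliers_def
      by (auto simp: linear_on_carrier_iff multiplier_scale_def zero_prod_def algebra_simps
          scale_right_distrib mult_scale scale_left_commute)
  qed (auto simp: multipliers_def multiplier_mul_def multiplier_scale_def linear_on_carrier_iff
      fun_eq_iff)
qed

lemma multiplier_comp_iff:
  "m \<in> multiplier_comp scale G A g \<longleftrightarrow> m \<in> multipliers scale \<and>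
     (\<forall>h\<in>carrier G. \<forall>x\<in>A h. fst m x \<in> A (h \<otimes> g) \<and> snd m x \<in> A (g \<otimes> h))"
  by (cases m) (auto simp: multiplier_comp_def image_subset_iff)

definition multiplier_part ::
  "'g \<Rightarrow> ('a \<Rightarrow> 'a) \<times> ('a \<Rightarrow> 'a) \<Rightarrow> ('a \<Rightarrow> 'a) \<times> ('a \<Rightarrow> 'a)" where
  "multiplier_part g m =
     (part_along (\<lambda>h. h \<otimes> g) (fst m), part_along (\<lambda>h. g \<otimes> h) (snd m))"

text \<open>
  Each multiplier identity for the part of degree \<open>g\<close>, evaluated at elements of degrees \<open>s\<close> and
  \<open>h\<close>, is one homogeneous component of the same identity for \<open>m\<close>: the one of degree \<open>s h g\<close>,
  \<open>g s h\<close> and \<open>s g h\<close> respectively.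
\<close>

lemma multiplier_part_in_comp:
  assumes m: "m \<in> multipliers scale" and g: "g \<in> carrier G"
  shows "multiplier_part g m \<in> multiplier_comp scale G A g"
proof -
  obtain R L where RL: "m = (R, L)" by (cases m)
  have lin: "Vector_Spaces.linear scale scale R" "Vector_Spaces.linear scale scale L"
    and R: "R (a * b) = a * R b" and L: "L (a * b) = L a * b" and bal: "R a * b = a * L b" for a b
    using m unfolding RL multipliers_def by auto
  define Rg where "Rg = part_along (\<lambda>h. h \<otimes> g) R"
  define Lg where "Lg = part_along (\<lambda>h. g \<otimes> h) L"
  have lin_g: "Vector_Spaces.linear scale scale Rg" "Vector_Spaces.linear scale scale Lg"
    unfolding Rg_def Lg_def using g by (auto intro!: linear_part_along lin)
  then have add: "Rg (x + y) = Rg x + Rg y" "Lg (x + y) = Lg x + Lg y" for x y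
    by (auto simp: linear_on_carrier_iff)
  have Rg: "Rg x = hom_part (h \<otimes> g) (R x)" and Lg: "Lg x = hom_part (g \<otimes> h) (L x)"
    if "h \<in> carrier G" "x \<in> A h" for h x
    unfolding Rg_def Lg_def
    using part_along_homogeneous[OF lin(1) _ that, of "\<lambda>h. h \<otimes> g"]
      part_along_homogeneous[OF lin(2) _ that, of "\<lambda>h. g \<otimes> h"] g by auto
  have "Rg (a * b) = a * Rg b" for a b
  proof (rule biadditive_eq_if_eq_on_homogeneous[of "\<lambda>a b. Rg (a * b)" "\<lambda>a b. a * Rg b"])
    fix s h a b assume s: "s \<in> carrier G" "a \<in> A s" and h: "h \<in> carrier G" "b \<in> A h"
    show "Rg (a * b) = a * Rg b"
      using Rg[OF _ comp_mul[OF s(1) h(1) s(2) h(2)]] Rg[OF h] hom_part_mult_left[OF s, of "h \<otimes> g" "R b"]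
        s h g by (simp add: R m_assoc)
  qed (simp_all add: add algebra_simps)
  moreover have "Lg (a * b) = Lg a * b" for a b
  proof (rule biadditive_eq_if_eq_on_homogeneous[of "\<lambda>a b. Lg (a * b)" "\<lambda>a b. Lg a * b"])
    fix s h a b assume s: "s \<in> carrier G" "a \<in> A s" and h: "h \<in> carrier G" "b \<in> A h"
    show "Lg (a * b) = Lg a * b"
      using Lg[OF _ comp_mul[OF s(1) h(1) s(2) h(2)]] Lg[OF s] hom_part_mult_right[OF h, of "g \<otimes> s" "L a"]
        s h g by (simp add: L m_assoc)
  qed (simp_all add: add algebra_simps)
  moreover have "Rg a * b = a * Lg b" for a b
  proof (rule biadditive_eq_if_eq_on_homogeneous[of "\<lambda>a b. Rg a * b" "\<lambda>a b. a * Lg b"])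
    fix s h a b assume s: "s \<in> carrier G" "a \<in> A s" and h: "h \<in> carrier G" "b \<in> A h"
    show "Rg a * b = a * Lg b"
      using Rg[OF s] Lg[OF h] hom_part_mult_right[OF h, of "s \<otimes> g" "R a"]
        hom_part_mult_left[OF s, of "g \<otimes> h" "L b"] s h g by (simp add: bal m_assoc)
  qed (simp_all add: add algebra_simps)
  moreover have "Rg x \<in> A (h \<otimes> g)" "Lg x \<in> A (g \<otimes> h)" if "h \<in> carrier G" "x \<in> A h" for h x
    using Rg Lg that g by auto
  ultimately show ?thesis
    unfolding multiplier_part_def multiplier_comp_iff multipliers_def RL
    using lin_g by (simp add: Rg_def Lg_def)
qed

lemma sum_fun_apply: "(\<Sum>i\<in>I. f i) x = (\<Sum>i\<in>I. f i x)"
  for f :: "'i \<Rightarrow> 'b \<Rightarrow> 'c::comm_monoid_add"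
  by (induction I rule: infinite_finite_induct) simp_all

lemma bij_betw_left_translation: "h \<in> carrier G \<Longrightarrow> bij_betw (\<lambda>g. h \<otimes> g) (carrier G) (carrier G)"
  by (rule bij_betw_byWitness[of _ "\<lambda>k. inv h \<otimes> k"]) (auto simp: m_assoc[symmetric])

lemma bij_betw_right_translation: "h \<in> carrier G \<Longrightarrow> bij_betw (\<lambda>g. g \<otimes> h) (carrier G) (carrier G)"
  by (rule bij_betw_byWitness[of _ "\<lambda>k. k \<otimes> inv h"]) (auto simp: m_assoc)

lemma sum_multiplier_part:
  assumes "m \<in> multipliers scale"
  shows "(\<Sum>g\<in>carrier G. multiplier_part g m) = m"
proof -
  have "Vector_Spaces.linear scale scale (fst m)" "Vector_Spaces.linear scale scale (snd m)"
    using assms by (auto simp: multipliers_def)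
  then have "(\<Sum>g\<in>carrier G. part_along (\<lambda>h. h \<otimes> g) (fst m) x) = fst m x"
    and "(\<Sum>g\<in>carrier G. part_along (\<lambda>h. g \<otimes> h) (snd m) x) = snd m x" for x
    using sum_part_along[of "fst m" "\<lambda>g h. h \<otimes> g" x]
      sum_part_along[of "snd m" "\<lambda>g h. g \<otimes> h" x]
      bij_betw_left_translation bij_betw_right_translation by blast+
  then show ?thesis
    by (auto simp: prod_eq_iff fun_eq_iff fst_sum snd_sum sum_fun_apply multiplier_part_def)
qed

lemma multiplier_part_unique:
  assumes m: "m \<in> multipliers scale"
    and f: "\<And>g. g \<in> carrier G \<Longrightarrow> f g \<in> multiplier_comp scale G A g"
    and sum: "(\<Sum>g\<in>carrier G. f g) = m"
    and g: "g \<in> carrier G"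
  shows "f g = multiplier_part g m"
proof -
  have lin: "Vector_Spaces.linear scale scale (fst m)" "Vector_Spaces.linear scale scale (snd m)"
    using m by (auto simp: multipliers_def)
  have lin_f: "Vector_Spaces.linear scale scale (fst (f k))"
    "Vector_Spaces.linear scale scale (snd (f k))" if "k \<in> carrier G" for k
    using f[OF that] by (auto simp: multiplier_comp_def multipliers_def)
  have f_in: "fst (f k) x \<in> A (h \<otimes> k)" "snd (f k) x \<in> A (k \<otimes> h)"
    if "k \<in> carrier G" "h \<in> carrier G" "x \<in> A h" for k h x
    using f[OF that(1)] that(2,3) by (auto simp: multiplier_comp_iff)
  have sums: "(\<Sum>k\<in>carrier G. fst (f k) x) = fst m x" "(\<Sum>k\<in>carrier G. snd (f k) x) = snd m x" for x
    by (simp_all add: sum[symmetric] fst_sum snd_sum sum_fun_apply)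
  have "fst (f g) = part_along (\<lambda>h. h \<otimes> g) (fst m)"
    by (rule part_along_unique[where \<sigma> = "\<lambda>g h. h \<otimes> g" and S = "\<lambda>g. fst (f g)"])
      (use bij_betw_left_translation in
        \<open>auto simp: lin lin_f f_in sums g bij_betw_def\<close>)
  moreover have "snd (f g) = part_along (\<lambda>h. g \<otimes> h) (snd m)"
    by (rule part_along_unique[where \<sigma> = "\<lambda>g h. g \<otimes> h" and S = "\<lambda>g. snd (f g)"])
      (use bij_betw_right_translation in
        \<open>auto simp: lin lin_f f_in sums g bij_betw_def\<close>)
  ultimately show ?thesis
    by (simp add: multiplier_part_def prod_eq_iff)
qed

lemma multiplier_direct_sum:
  assumes m: "m \<in> multipliers scale"
  shows "\<exists>!f. (\<forall>g\<in>carrier G. f g \<in> multiplier_comp scale G A g) \<and>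
     (\<forall>g. g \<notin> carrier G \<longrightarrow> f g = 0) \<and> finite {g. f g \<noteq> 0} \<and> m = (\<Sum>g | f g \<noteq> 0. f g)"
proof (rule ex1I)
  let ?f = "\<lambda>g. if g \<in> carrier G then multiplier_part g m else 0"
  have z: "\<forall>g. g \<notin> carrier G \<longrightarrow> ?f g = 0" by simp
  show "(\<forall>g\<in>carrier G. ?f g \<in> multiplier_comp scale G A g) \<and>
     (\<forall>g. g \<notin> carrier G \<longrightarrow> ?f g = 0) \<and> finite {g. ?f g \<noteq> 0} \<and> m = (\<Sum>g | ?f g \<noteq> 0. ?f g)"
    unfolding sum_support_eq_sum_carrier[OF z] using finite_support[OF z]
    by (simp add: multiplier_part_in_comp[OF m] sum_multiplier_part[OF m])
  fix f
  assume f: "(\<forall>g\<in>carrier G. f g \<in> multiplier_comp scale G A g) \<and>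
     (\<forall>g. g \<notin> carrier G \<longrightarrow> f g = 0) \<and> finite {g. f g \<noteq> 0} \<and> m = (\<Sum>g | f g \<noteq> 0. f g)"
  then have sum: "(\<Sum>g\<in>carrier G. f g) = m"
    using sum_support_eq_sum_carrier[of f] by simp
  have f_in: "f g \<in> multiplier_comp scale G A g" if "g \<in> carrier G" for g
    using f that by blast
  have f_out: "f g = 0" if "g \<notin> carrier G" for g
    using f that by blast
  show "f = ?f"
    by (rule ext) (simp add: f_out multiplier_part_unique[OF m f_in sum])
qed

lemma graded_algebra_on_multipliers:
  "graded_algebra_on (multiplier_scale scale) multiplier_mul (multipliers scale) G
     (multiplier_comp scale G A)"
proof -
  interpret M: algebra_on "multiplier_scale scale" multiplier_mul "multipliers scale"
    by (rule algebra_on_multipliers)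
  show ?thesis
  proof
    show "M.subspace (multiplier_comp scale G A g)" if g: "g \<in> carrier G" for g
    proof -
      have sub: "subspace (A (h \<otimes> g))" "subspace (A (g \<otimes> h))" if "h \<in> carrier G" for h
        using comp_subspace g that by auto
      show ?thesis
        using M.subspace_carrier unfolding M.subspace_def
        by (auto simp: multiplier_comp_iff multiplier_scale_def case_prod_beta
            intro: subspace_0 subspace_add subspace_scale sub)
    qed
    show "multiplier_comp scale G A g \<subseteq> multipliers scale" for g
      by (auto simp: multiplier_comp_def)
    show "multiplier_mul p q \<in> multiplier_comp scale G A (g \<otimes> h)"
      if gh: "g \<in> carrier G" "h \<in> carrier G"
        and p: "p \<in> multiplier_comp scale G A g" and q: "q \<in> multiplier_comp scale G A h"
      for g h p q
    proof -
      have "multiplier_mul p q \<in> multipliers scale"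
        using p q by (intro M.mul_closed) (auto simp: multiplier_comp_def)
      moreover have "fst q (fst p x) \<in> A (k \<otimes> (g \<otimes> h))" "snd p (snd q x) \<in> A (g \<otimes> h \<otimes> k)"
        if k: "k \<in> carrier G" "x \<in> A k" for k x
      proof -
        have "fst p x \<in> A (k \<otimes> g)" "snd q x \<in> A (h \<otimes> k)"
          using p q k by (auto simp: multiplier_comp_iff)
        then have "fst q (fst p x) \<in> A ((k \<otimes> g) \<otimes> h)" "snd p (snd q x) \<in> A (g \<otimes> (h \<otimes> k))"
          using p q k gh by (auto simp: multiplier_comp_iff)
        then show "fst q (fst p x) \<in> A (k \<otimes> (g \<otimes> h))" "snd p (snd q x) \<in> A (g \<otimes> h \<otimes> k)"
          using k gh by (simp_all add: m_assoc)
      qed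
      ultimately show ?thesis
        by (auto simp: multiplier_comp_iff multiplier_mul_def case_prod_beta)
    qed
  qed (rule multiplier_direct_sum)
qed

end

theorem proposition2p3:
  fixes scale :: "'f::field_char_0 \<Rightarrow> 'a::ring \<Rightarrow> 'a"
    and G :: "('g, 'm) monoid_scheme"
    and A :: "'g \<Rightarrow> 'a set"
  assumes "group G"
    and "finite (carrier G)"
    and "graded_algebra_on scale (*) UNIV G A"
  shows "graded_algebra_on (multiplier_scale scale) multiplier_mul (multipliers scale) G
           (multiplier_comp scale G A)"
proof -
  interpret finite_graded_ring scale G A
    by (intro finite_graded_ring.intro finite_graded_ring_axioms.intro assms)
  show ?thesis
    by (rule graded_algebra_on_multipliers)
qed

end
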